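(* Let $X$ be a real random variable having finite moments of all orders. The real vector space spanned by the identity operator and the annihilation, preservation and creation operators of $X$, equipped with the bracket given by the commutator, forms a Lie algebra (i.e. is closed under the commutator) if and only if $X$ is of Meixner–Lie class $\mathcal{M}_L$.
   Context: Let $X$ be a (classical) real random variable with finite moments of all orders and let $f_0,f_1,\dots$ be the monic orthogonal polynomials generated by $X$ (i.e. orthogonal for the distribution of $X$); if $X$ takes exactly $k$ values with positive probability only $f_0,\dots,f_{k-1}$ are non-zero as elements of $L^2$. They satisfy $Xf_n(X)=f_{n+1}(X)+\alpha_nf_n(X)+\omega_nf_{n-1}(X)$, with Szegő–Jacobi parameters $\alpha_n,\omega_n$ (and $f_k(X)=0$ in the finite case). The creation, preservation and annihilation operators of $X$ are the linear operators on the space of polynomial functions of $X$ given by $a^+f_n(X)=f_{n+1}(X)$, $a^0f_n(X)=\alpha_nf_n(X)$, $a^-f_n(X)=\omega_nf_{n-1}(X)$ (with $a^-f_0=0$), so that multiplication by $X$ equals $a^-+a^0+a^+$. $[A,B]=AB-BA$. The Meixner–Lie class is $\mathcal{M}_L:=\mathcal{M}_{u,f}\cup\mathcal{M}_{b,f}$, where: - $\mathcal{M}_{u,f}$ is the class of random variables with infinite support with $\alpha_n=\alpha n+\alpha_0$ ($n\ge0$) and $\omega_n=\beta n^2+(t-\beta)n$ ($n\ge1$) for some real $\alpha,\beta,t$ with $\beta\ge0$, $t>0$, such that $\alpha\ne0$ or $\alpha=\beta=0$; - $\mathcal{M}_{b,f}$ is the class of non-symmetric binomial random variables, i.e. random variables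 taking exactly $k$ values with positive probability (for some integer $k\ge1$) for which there are real $\alpha,\beta,t$ (with $t>0$ if $k\ge2$) such that $\alpha_n=\alpha n+\alpha_0$ for $0\le n\le k-1$, $\omega_n=\beta n^2+(t-\beta)n$ for $1\le n\le k-1$, $t=-\beta(k-1)$ and $\alpha\neq0$. *)

theory Defs
  imports "HOL-Probability.Probability" "HOL-Computational_Algebra.Polynomial"
begin

section \<open>Polynomial functions of a random variable, as elements of L2\<close>

text \<open>
  The polynomial function \<open>p(X)\<close>, as an element of \<open>L\<^sup>2\<close>, is represented by the set of all
  polynomials \<open>q\<close> with \<open>q(X) = p(X)\<close> almost surely. The space of polynomial functions of \<open>X\<close> is
  thus the quotient of the polynomials by almost sure equality: it has dimension \<open>k\<close> if \<open>X\<close> takes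
  exactly \<open>k\<close> values, and is isomorphic to the polynomials if \<open>X\<close> has infinite support.
\<close>

definition polyfun :: "'a measure \<Rightarrow> ('a \<Rightarrow> real) \<Rightarrow> real poly \<Rightarrow> real poly set" where
  "polyfun M X p = {q. AE w in M. poly q (X w) = poly p (X w)}"

definition polyfun_space :: "'a measure \<Rightarrow> ('a \<Rightarrow> real) \<Rightarrow> real poly set set" where
  "polyfun_space M X = range (polyfun M X)"

definition polyfun_add ::
  "'a measure \<Rightarrow> ('a \<Rightarrow> real) \<Rightarrow> real poly set \<Rightarrow> real poly set \<Rightarrow> real poly set" where
  "polyfun_add M X U V = (\<Union>p\<in>U. \<Union>q\<in>V. polyfun M X (p + q))"

definition polyfun_scale ::
  "'a measure \<Rightarrow> ('a \<Rightarrow> real) \<Rightarrow> real \<Rightarrow> real poly set \<Rightarrow> real poly set" where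
  "polyfun_scale M X c U = (\<Union>p\<in>U. polyfun M X (smult c p))"


section \<open>Monic orthogonal polynomials and Szego-Jacobi parameters\<close>

definition monic_orthogonal :: "'a measure \<Rightarrow> ('a \<Rightarrow> real) \<Rightarrow> (nat \<Rightarrow> real poly) \<Rightarrow> bool" where
  "monic_orthogonal M X f \<longleftrightarrow>
     (\<forall>n. degree (f n) = n \<and> lead_coeff (f n) = 1) \<and>
     (\<forall>m n. m \<noteq> n \<longrightarrow> (\<integral>w. poly (f m) (X w) * poly (f n) (X w) \<partial>M) = 0)"

text \<open>
  If \<open>X\<close> takes exactly \<open>k\<close> values, the polynomials \<open>f\<^sub>n\<close> with \<open>n > k\<close> are not unique, but
  all \<open>f\<^sub>n\<close> with \<open>n \<ge> k\<close> vanish in \<open>L\<^sup>2\<close>. The class of \<open>f\<^sub>n(X)\<close> is unique in all cases.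
\<close>

definition orth_poly :: "'a measure \<Rightarrow> ('a \<Rightarrow> real) \<Rightarrow> nat \<Rightarrow> real poly" where
  "orth_poly M X = (SOME f. monic_orthogonal M X f)"

definition orth_nonzero :: "'a measure \<Rightarrow> ('a \<Rightarrow> real) \<Rightarrow> nat \<Rightarrow> bool" where
  "orth_nonzero M X n \<longleftrightarrow> \<not> (AE w in M. poly (orth_poly M X n) (X w) = 0)"

text \<open>
  The three-term recurrence, required for those \<open>n\<close> with \<open>f\<^sub>n(X) \<noteq> 0\<close>; it determines \<open>\<alpha>\<^sub>n\<close>
  for these \<open>n\<close>, and \<open>\<omega>\<^sub>n\<close> for these \<open>n \<ge> 1\<close>. All other values of the choice below are
  arbitrary and never used.
\<close>

definition three_term_recurrence ::
  "'a measure \<Rightarrow> ('a \<Rightarrow> real) \<Rightarrow> (nat \<Rightarrow> real) \<times> (nat \<Rightarrow> real) \<Rightarrow> bool" where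
  "three_term_recurrence M X = (\<lambda>(a, b). \<forall>n. orth_nonzero M X n \<longrightarrow>
     (AE w in M. X w * poly (orth_poly M X n) (X w) =
        poly (orth_poly M X (Suc n)) (X w) + a n * poly (orth_poly M X n) (X w)
        + (if n = 0 then 0 else b n * poly (orth_poly M X (n - 1)) (X w))))"

definition szego_jacobi ::
  "'a measure \<Rightarrow> ('a \<Rightarrow> real) \<Rightarrow> (nat \<Rightarrow> real) \<times> (nat \<Rightarrow> real)" where
  "szego_jacobi M X = (SOME ab. three_term_recurrence M X ab)"

definition sj_alpha :: "'a measure \<Rightarrow> ('a \<Rightarrow> real) \<Rightarrow> nat \<Rightarrow> real" where
  "sj_alpha M X = fst (szego_jacobi M X)"

definition sj_omega :: "'a measure \<Rightarrow> ('a \<Rightarrow> real) \<Rightarrow> nat \<Rightarrow> real" where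
  "sj_omega M X = snd (szego_jacobi M X)"


section \<open>Operators\<close>

definition polyfun_linear ::
  "'a measure \<Rightarrow> ('a \<Rightarrow> real) \<Rightarrow> (real poly set \<Rightarrow> real poly set) \<Rightarrow> bool" where
  "polyfun_linear M X A \<longleftrightarrow>
     A \<in> polyfun_space M X \<rightarrow>\<^sub>E polyfun_space M X \<and>
     (\<forall>U\<in>polyfun_space M X. \<forall>V\<in>polyfun_space M X.
        A (polyfun_add M X U V) = polyfun_add M X (A U) (A V)) \<and>
     (\<forall>c. \<forall>U\<in>polyfun_space M X. A (polyfun_scale M X c U) = polyfun_scale M X c (A U))"

text \<open>The linear operator with \<open>f\<^sub>n(X) \<mapsto> g\<^sub>n(X)\<close> for all \<open>n\<close> with \<open>f\<^sub>n(X) \<noteq> 0\<close>.\<close>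

definition basis_operator ::
  "'a measure \<Rightarrow> ('a \<Rightarrow> real) \<Rightarrow> (nat \<Rightarrow> real poly) \<Rightarrow> real poly set \<Rightarrow> real poly set" where
  "basis_operator M X g = (THE A. polyfun_linear M X A \<and>
     (\<forall>n. orth_nonzero M X n \<longrightarrow> A (polyfun M X (orth_poly M X n)) = polyfun M X (g n)))"

definition creation :: "'a measure \<Rightarrow> ('a \<Rightarrow> real) \<Rightarrow> real poly set \<Rightarrow> real poly set" where
  "creation M X = basis_operator M X (\<lambda>n. orth_poly M X (Suc n))"

definition preservation :: "'a measure \<Rightarrow> ('a \<Rightarrow> real) \<Rightarrow> real poly set \<Rightarrow> real poly set" where
  "preservation M X = basis_operator M X (\<lambda>n. smult (sj_alpha M X n) (orth_poly M X n))"

definition annihilation :: "'a measure \<Rightarrow> ('a \<Rightarrow> real) \<Rightarrow> real poly set \<Rightarrow> real poly set" where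
  "annihilation M X = basis_operator M X
     (\<lambda>n. if n = 0 then 0 else smult (sj_omega M X n) (orth_poly M X (n - 1)))"

definition id_op :: "'a measure \<Rightarrow> ('a \<Rightarrow> real) \<Rightarrow> real poly set \<Rightarrow> real poly set" where
  "id_op M X = (\<lambda>U\<in>polyfun_space M X. U)"

definition op_add :: "'a measure \<Rightarrow> ('a \<Rightarrow> real) \<Rightarrow> (real poly set \<Rightarrow> real poly set) \<Rightarrow>
    (real poly set \<Rightarrow> real poly set) \<Rightarrow> real poly set \<Rightarrow> real poly set" where
  "op_add M X A B = (\<lambda>U\<in>polyfun_space M X. polyfun_add M X (A U) (B U))"

definition op_scale :: "'a measure \<Rightarrow> ('a \<Rightarrow> real) \<Rightarrow> real \<Rightarrow>
    (real poly set \<Rightarrow> real poly set) \<Rightarrow> real poly set \<Rightarrow> real poly set" where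
  "op_scale M X c A = (\<lambda>U\<in>polyfun_space M X. polyfun_scale M X c (A U))"

definition op_comp :: "'a measure \<Rightarrow> ('a \<Rightarrow> real) \<Rightarrow> (real poly set \<Rightarrow> real poly set) \<Rightarrow>
    (real poly set \<Rightarrow> real poly set) \<Rightarrow> real poly set \<Rightarrow> real poly set" where
  "op_comp M X A B = (\<lambda>U\<in>polyfun_space M X. A (B U))"

definition commutator :: "'a measure \<Rightarrow> ('a \<Rightarrow> real) \<Rightarrow> (real poly set \<Rightarrow> real poly set) \<Rightarrow>
    (real poly set \<Rightarrow> real poly set) \<Rightarrow> real poly set \<Rightarrow> real poly set" where
  "commutator M X A B = op_add M X (op_comp M X A B) (op_scale M X (- 1) (op_comp M X B A))"

definition quantum_span ::
  "'a measure \<Rightarrow> ('a \<Rightarrow> real) \<Rightarrow> (real poly set \<Rightarrow> real poly set) set" where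
  "quantum_span M X =
     {op_add M X (op_scale M X c0 (id_op M X))
       (op_add M X (op_scale M X c1 (annihilation M X))
         (op_add M X (op_scale M X c2 (preservation M X))
           (op_scale M X c3 (creation M X)))) | c0 c1 c2 c3. True}"

text \<open>
  A linear space of operators is a Lie algebra under the commutator iff it is closed under it;
  bilinearity, antisymmetry and the Jacobi identity hold for every commutator.
\<close>

definition commutator_closed :: "'a measure \<Rightarrow> ('a \<Rightarrow> real) \<Rightarrow>
    (real poly set \<Rightarrow> real poly set) set \<Rightarrow> bool" where
  "commutator_closed M X S \<longleftrightarrow> (\<forall>A\<in>S. \<forall>B\<in>S. commutator M X A B \<in> S)"


section \<open>The Meixner--Lie class\<close>

definition rv_support :: "'a measure \<Rightarrow> ('a \<Rightarrow> real) \<Rightarrow> real set" where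
  "rv_support M X = {x. \<forall>e>0. measure M {w \<in> space M. X w \<in> ball x e} > 0}"

definition takes_exactly :: "'a measure \<Rightarrow> ('a \<Rightarrow> real) \<Rightarrow> nat \<Rightarrow> bool" where
  "takes_exactly M X k \<longleftrightarrow> (\<exists>S. finite S \<and> card S = k \<and>
     (AE w in M. X w \<in> S) \<and> (\<forall>x\<in>S. measure M {w \<in> space M. X w = x} > 0))"

definition meixner_u_f :: "'a measure \<Rightarrow> ('a \<Rightarrow> real) \<Rightarrow> bool" where
  "meixner_u_f M X \<longleftrightarrow> infinite (rv_support M X) \<and>
     (\<exists>\<alpha> \<beta> t. \<beta> \<ge> 0 \<and> t > 0 \<and> (\<alpha> \<noteq> 0 \<or> \<alpha> = 0 \<and> \<beta> = 0) \<and>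
        (\<forall>n. sj_alpha M X n = \<alpha> * real n + sj_alpha M X 0) \<and>
        (\<forall>n\<ge>1. sj_omega M X n = \<beta> * real n ^ 2 + (t - \<beta>) * real n))"

definition meixner_b_f :: "'a measure \<Rightarrow> ('a \<Rightarrow> real) \<Rightarrow> bool" where
  "meixner_b_f M X \<longleftrightarrow> (\<exists>k\<ge>1. takes_exactly M X k \<and>
     (\<exists>\<alpha> \<beta> t. (k \<ge> 2 \<longrightarrow> t > 0) \<and>
        (\<forall>n\<le>k - 1. sj_alpha M X n = \<alpha> * real n + sj_alpha M X 0) \<and>
        (\<forall>n\<in>{1..k - 1}. sj_omega M X n = \<beta> * real n ^ 2 + (t - \<beta>) * real n) \<and>
        t = - \<beta> * (real k - 1) \<and> \<alpha> \<noteq> 0))"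

definition meixner_lie :: "'a measure \<Rightarrow> ('a \<Rightarrow> real) \<Rightarrow> bool" where
  "meixner_lie M X \<longleftrightarrow> meixner_u_f M X \<or> meixner_b_f M X"


section \<open>The choices above are well defined\<close>

text \<open>
  If \<open>X\<close> has moments of all orders, then \<open>orth_poly\<close>, \<open>szego_jacobi\<close> and \<open>basis_operator\<close>
  satisfy their defining properties. These are \<open>monic_orthogonal_orth_poly\<close>,
  \<open>three_term_recurrence_szego_jacobi\<close> and \<open>basis_operator_ex1\<close>; the orthogonal polynomials
  are constructed by Gram-Schmidt orthogonalisation.
\<close>

lemma monic_orthogonal_nth:
  assumes "monic_orthogonal M X f"
  shows "degree (f n) = n" "coeff (f n) n = 1"
  using assms unfolding monic_orthogonal_def by metis+

lemma monic_expansion: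
  fixes f :: "nat \<Rightarrow> real poly"
  assumes f: "\<And>n. degree (f n) = n" "\<And>n. coeff (f n) n = 1" and "degree p < N"
  shows "\<exists>c. p = (\<Sum>m<N. smult (c m) (f m))"
  using \<open>degree p < N\<close>
proof (induction N arbitrary: p)
  case (Suc N)
  define q where "q = p - smult (coeff p N) (f N)"
  have q: "degree q < N \<or> q = 0"
  proof (cases "N = 0")
    case True
    have "degree q \<le> 0"
      unfolding q_def using Suc.prems f(1)[of 0] True by (intro degree_diff_le) auto
    moreover have "coeff q 0 = 0" unfolding q_def using f(2)[of 0] True by simp
    ultimately have "q = 0" by (metis le_zero_eq leading_coeff_0_iff)
    then show ?thesis ..
  next
    case False
    have "degree q \<le> N" unfolding q_def using Suc.prems f(1)[of N]
      by (intro degree_diff_le) auto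
    moreover have "coeff q N = 0" unfolding q_def using f(2)[of N] by simp
    ultimately show ?thesis using False
      by (metis le_neq_implies_less leading_coeff_0_iff)
  qed
  have "\<exists>c. q = (\<Sum>m<N. smult (c m) (f m))"
  proof (cases "q = 0")
    case True
    then show ?thesis by (intro exI[of _ "\<lambda>_. 0"]) simp
  qed (use q Suc.IH in blast)
  then obtain c where c: "q = (\<Sum>m<N. smult (c m) (f m))" ..
  have "p = (\<Sum>m<Suc N. smult ((c(N := coeff p N)) m) (f m))"
    using c q_def by (simp add: algebra_simps)
  then show ?case by blast
qed simp

context
  fixes M :: "'a measure" and X :: "'a \<Rightarrow> real"
  assumes M: "prob_space M" and X[measurable]: "X \<in> borel_measurable M"
    and moments: "\<And>n::nat. integrable M (\<lambda>w. X w ^ n)"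
begin

private definition E :: "real poly \<Rightarrow> real" where
  "E p = (\<integral>w. poly p (X w) \<partial>M)"

lemma poly_integrable: "integrable M (\<lambda>w. poly p (X w))"
  unfolding poly_altdef by (intro Bochner_Integration.integrable_sum integrable_mult_right moments)

private lemma E_simps: "E (p + q) = E p + E q" "E (p - q) = E p - E q" "E (smult c p) = c * E p" "E 0 = 0"
  unfolding E_def using poly_integrable by simp_all

private lemma E_sum: "E (\<Sum>i\<in>I. g i) = (\<Sum>i\<in>I. E (g i))"
  by (induction I rule: infinite_finite_induct) (simp_all add: E_simps)

private lemma null_iff: "(AE w in M. poly p (X w) = 0) \<longleftrightarrow> E (p * p) = 0"
proof -
  have "E (p * p) = 0 \<longleftrightarrow> (AE w in M. poly (p * p) (X w) = 0)"
    unfolding E_def by (intro integral_nonneg_eq_0_iff_AE poly_integrable) auto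
  then show ?thesis by simp
qed

private lemma null_mult: "(AE w in M. poly p (X w) = 0) \<Longrightarrow> E (p * q) = 0"
  unfolding E_def by (rule integral_eq_zero_AE) auto

private fun gs :: "nat \<Rightarrow> real poly" where
  "gs n = monom 1 n - (\<Sum>m\<leftarrow>[0..<n]. smult (E (monom 1 n * gs m) / E (gs m * gs m)) (gs m))"

declare gs.simps[simp del]

private lemma gs: "gs n = monom 1 n - (\<Sum>m<n. smult (E (monom 1 n * gs m) / E (gs m * gs m)) (gs m))"
  by (subst gs.simps) (simp add: interv_sum_list_conv_sum_set_nat atLeast0LessThan)

private lemma gs_degree: "degree (gs n) = n \<and> coeff (gs n) n = 1"
proof (induction n rule: less_induct)
  case (less n)
  define s where "s = (\<Sum>m<n. smult (E (monom 1 n * gs m) / E (gs m * gs m)) (gs m))"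
  have eq: "gs n = monom 1 n - s" unfolding s_def by (rule gs)
  have c: "coeff s j = 0" if "j \<ge> n" for j
    unfolding s_def coeff_sum using less that by (auto intro!: sum.neutral simp: coeff_eq_0)
  have "coeff (gs n) n = 1" using c[of n] by (simp add: eq)
  moreover have "degree (gs n) \<le> n"
    using c by (intro degree_le) (auto simp: eq)
  ultimately show ?case by (metis le_antisym le_degree zero_neq_one)
qed

private lemma gs_orth: "m < n \<Longrightarrow> E (gs n * gs m) = 0"
proof (induction n arbitrary: m rule: less_induct)
  case (less n)
  have orth: "E (gs j * gs m) = 0" if "j < n" "j \<noteq> m" for j
    using less.IH[of j m] less.IH[of m j] that less.prems by (cases "j < m") (auto simp: mult.commute)
  let ?c = "\<lambda>j. E (monom 1 n * gs j) / E (gs j * gs j)"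
  have "E (gs n * gs m) = E (monom 1 n * gs m) - (\<Sum>j<n. ?c j * E (gs j * gs m))"
    by (subst gs) (simp add: algebra_simps sum_distrib_left sum_distrib_right E_simps E_sum)
  also have "(\<Sum>j<n. ?c j * E (gs j * gs m)) = (\<Sum>j\<in>{m}. ?c j * E (gs j * gs m))"
    using less.prems orth by (intro sum.mono_neutral_right) auto
  finally show ?case
    using null_mult[of "gs m" "monom 1 n"] null_iff[of "gs m"]
    by (cases "E (gs m * gs m) = 0") (auto simp: mult.commute)
qed

private lemma E_mult: "E (p * q) = (\<integral>w. poly p (X w) * poly q (X w) \<partial>M)"
  by (simp add: E_def)

lemma monic_orthogonal_orth_poly: "monic_orthogonal M X (orth_poly M X)"
proof -
  have "E (gs m * gs n) = 0" if "m \<noteq> n" for m n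
    using that gs_orth[of m n] gs_orth[of n m] by (cases "m < n") (auto simp: mult.commute)
  then have "monic_orthogonal M X gs"
    unfolding monic_orthogonal_def using gs_degree by (simp add: E_mult)
  then show ?thesis unfolding orth_poly_def by (rule someI[of "monic_orthogonal M X"])
qed

private abbreviation "f \<equiv> orth_poly M X"

private lemma f_orth: "m \<noteq> n \<Longrightarrow> E (f m * f n) = 0"
  using monic_orthogonal_orth_poly unfolding monic_orthogonal_def by (simp add: E_mult)

private lemmas f_nth = monic_orthogonal_nth[OF monic_orthogonal_orth_poly]

private lemma f_expand: "degree p < N \<Longrightarrow> \<exists>c. p = (\<Sum>m<N. smult (c m) (f m))"
  by (rule monic_expansion) (use f_nth in auto)

private lemma E_expand: "E ((\<Sum>m<N. smult (c m) (f m)) * f n) = (if n < N then c n * E (f n * f n) else 0)"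
proof -
  have "E ((\<Sum>m<N. smult (c m) (f m)) * f n) = (\<Sum>m<N. c m * E (f m * f n))"
    by (simp add: sum_distrib_right E_sum E_simps)
  also have "\<dots> = (\<Sum>m<N. if m = n then c n * E (f n * f n) else 0)"
    by (intro sum.cong) (auto simp: f_orth)
  finally show ?thesis by simp
qed

private lemma f_low: "degree p < n \<Longrightarrow> E (p * f n) = 0"
  using f_expand[of p n] E_expand[of _ n n] by auto

private lemma orth_nonzero_iff: "orth_nonzero M X n \<longleftrightarrow> E (f n * f n) \<noteq> 0"
  unfolding orth_nonzero_def null_iff ..

lemma three_term_recurrence_szego_jacobi: "three_term_recurrence M X (szego_jacobi M X)"
proof -
  have "\<exists>ab. AE w in M. X w * poly (f n) (X w) = poly (f (Suc n)) (X w) + fst ab * poly (f n) (X w)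
        + (if n = 0 then 0 else snd ab * poly (f (n - 1)) (X w))" for n
  proof -
    define q where "q = pCons 0 (f n) - f (Suc n)"
    have "f n \<noteq> 0" using f_nth(2)[of n] by auto
    then have "degree q \<le> Suc n"
      unfolding q_def using f_nth(1)[of n] f_nth(1)[of "Suc n"] by (intro degree_diff_le) auto
    moreover have "coeff q (Suc n) = 0" unfolding q_def using f_nth(2)[of n] f_nth(2)[of "Suc n"] by simp
    ultimately have "degree q < Suc n"
      by (metis Zero_not_Suc degree_0 le_neq_implies_less leading_coeff_0_iff zero_less_Suc)
    from f_expand[OF this] obtain c where c: "q = (\<Sum>m<Suc n. smult (c m) (f m))" ..
    have z: "AE w in M. c m * poly (f m) (X w) = 0" if "m < n - 1" for m
    proof -
      have "c m * E (f m * f m) = E (q * f m)" using E_expand[of c "Suc n" m] that c by auto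
      also have "\<dots> = E (pCons 0 (f m) * f n) - E (f (Suc n) * f m)"
        unfolding q_def left_diff_distrib E_simps by (simp add: mult.commute)
      also have "E (pCons 0 (f m) * f n) = 0"
        using that f_nth(1)[of m] by (intro f_low) (auto simp: degree_pCons_eq_if)
      also have "E (f (Suc n) * f m) = 0" using that by (intro f_orth) auto
      finally show ?thesis using null_iff[of "f m"] by auto
    qed
    have "AE w in M. \<forall>m\<in>{..<n-1}. c m * poly (f m) (X w) = 0"
      using z by (intro AE_finite_allI) auto
    then have "AE w in M. X w * poly (f n) (X w) = poly (f (Suc n)) (X w) + c n * poly (f n) (X w)
        + (if n = 0 then 0 else c (n - 1) * poly (f (n - 1)) (X w))"
    proof eventually_elim
      case (elim w)
      have "X w * poly (f n) (X w) - poly (f (Suc n)) (X w) = poly q (X w)"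
        unfolding q_def by simp
      also have "\<dots> = (\<Sum>m<Suc n. c m * poly (f m) (X w))" by (subst c) (simp add: poly_sum)
      also have "\<dots> = c n * poly (f n) (X w) + (if n = 0 then 0 else c (n - 1) * poly (f (n - 1)) (X w))"
        using elim by (cases n) (auto intro!: sum.neutral)
      finally show ?case by simp
    qed
    then show ?thesis by (intro exI[of _ "(c n, c (n - 1))"]) auto
  qed
  then obtain ab where "\<forall>n. AE w in M. X w * poly (f n) (X w) = poly (f (Suc n)) (X w)
       + fst (ab n) * poly (f n) (X w) + (if n = 0 then 0 else snd (ab n) * poly (f (n - 1)) (X w))"
    by (rule choice[OF allI, THEN exE])
  then have "three_term_recurrence M X (fst \<circ> ab, snd \<circ> ab)"
    unfolding three_term_recurrence_def prod.case comp_apply by blast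
  then show ?thesis unfolding szego_jacobi_def by (rule someI[of "three_term_recurrence M X"])
qed

lemma polyfun_eq_iff: "polyfun M X p = polyfun M X q \<longleftrightarrow> (AE w in M. poly p (X w) = poly q (X w))"
proof
  assume "polyfun M X p = polyfun M X q"
  moreover have "p \<in> polyfun M X p" by (simp add: polyfun_def)
  ultimately show "AE w in M. poly p (X w) = poly q (X w)" by (auto simp: polyfun_def)
next
  assume eq: "AE w in M. poly p (X w) = poly q (X w)"
  have "(AE w in M. poly r (X w) = poly p (X w)) \<longleftrightarrow> (AE w in M. poly r (X w) = poly q (X w))" for r
  proof
    assume "AE w in M. poly r (X w) = poly p (X w)"
    with eq show "AE w in M. poly r (X w) = poly q (X w)" by eventually_elim simp
  next
    assume "AE w in M. poly r (X w) = poly q (X w)"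
    with eq show "AE w in M. poly r (X w) = poly p (X w)" by eventually_elim simp
  qed
  then show "polyfun M X p = polyfun M X q" by (simp add: polyfun_def)
qed

lemma polyfun_add_polyfun: "polyfun_add M X (polyfun M X p) (polyfun M X q) = polyfun M X (p + q)"
proof -
  have "polyfun M X (p' + q') = polyfun M X (p + q)"
    if "p' \<in> polyfun M X p" "q' \<in> polyfun M X q" for p' q'
  proof -
    have "AE w in M. poly p' (X w) = poly p (X w)" "AE w in M. poly q' (X w) = poly q (X w)"
      using that by (auto simp: polyfun_def)
    then have "AE w in M. poly (p' + q') (X w) = poly (p + q) (X w)" by eventually_elim simp
    then show ?thesis by (simp only: polyfun_eq_iff)
  qed
  moreover have "p \<in> polyfun M X p" for p by (simp add: polyfun_def)
  ultimately show ?thesis unfolding polyfun_add_def by blast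
qed

lemma polyfun_scale_polyfun: "polyfun_scale M X c (polyfun M X p) = polyfun M X (smult c p)"
proof -
  have "polyfun M X (smult c p') = polyfun M X (smult c p)" if "p' \<in> polyfun M X p" for p'
  proof -
    have "AE w in M. poly p' (X w) = poly p (X w)"
      using that by (auto simp: polyfun_def)
    then have "AE w in M. poly (smult c p') (X w) = poly (smult c p) (X w)" by eventually_elim simp
    then show ?thesis by (simp only: polyfun_eq_iff)
  qed
  moreover have "p \<in> polyfun M X p" for p by (simp add: polyfun_def)
  ultimately show ?thesis unfolding polyfun_scale_def by blast
qed

private lemma T_null:
  assumes "AE w in M. poly p (X w) = poly q (X w)"
  shows "E (p * f n) = E (q * f n)"
proof -
  have "AE w in M. poly (p - q) (X w) = 0" using assms by eventually_elim simp
  then have "E ((p - q) * f n) = 0" by (rule null_mult)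
  then show ?thesis by (simp add: algebra_simps E_simps)
qed

lemma basis_operator_ex1:
  "\<exists>!A. polyfun_linear M X A \<and>
     (\<forall>n. orth_nonzero M X n \<longrightarrow> A (polyfun M X (f n)) = polyfun M X (g n))"
proof (rule ex_ex1I)
  define c where "c n p = E (p * f n) / E (f n * f n)" for n p
  have c0: "c n p = 0" if "degree p < n" for n p using f_low[OF that] by (simp add: c_def)
  define T where "T p = (\<Sum>n\<le>degree p. smult (c n p) (g n))" for p
  have T: "T p = (\<Sum>n\<le>N. smult (c n p) (g n))" if "degree p \<le> N" for p N
    unfolding T_def using that by (intro sum.mono_neutral_left) (auto simp: c0)
  have Tadd: "T (p + q) = T p + T q" for p q
  proof -
    let ?N = "max (degree p) (degree q)"
    have "degree (p + q) \<le> ?N" "degree p \<le> ?N" "degree q \<le> ?N" by (auto intro: degree_add_le_max)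
    then show ?thesis unfolding T[OF \<open>degree (p + q) \<le> ?N\<close>] T[OF \<open>degree p \<le> ?N\<close>] T[OF \<open>degree q \<le> ?N\<close>]
      by (simp add: c_def algebra_simps E_simps add_divide_distrib smult_add_left sum.distrib)
  qed
  have Tsc: "T (smult a p) = smult a (T p)" for a p
    unfolding T[OF degree_smult_le] T_def
    by (intro poly_eqI) (simp add: c_def E_simps coeff_sum sum_distrib_left mult.assoc)
  have Tcong: "T p = T q" if "AE w in M. poly p (X w) = poly q (X w)" for p q
  proof -
    let ?N = "max (degree p) (degree q)"
    show ?thesis using T[of p ?N] T[of q ?N] T_null[OF that] by (simp add: c_def)
  qed
  define A where "A = (\<lambda>U\<in>polyfun_space M X. polyfun M X (T (SOME p. p \<in> U)))"
  have A: "A (polyfun M X p) = polyfun M X (T p)" for p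
  proof -
    have "(SOME r. r \<in> polyfun M X p) \<in> polyfun M X p"
      by (rule someI[of _ p]) (simp add: polyfun_def)
    then have "T (SOME r. r \<in> polyfun M X p) = T p" by (intro Tcong) (simp add: polyfun_def)
    then show ?thesis by (simp add: A_def polyfun_space_def)
  qed
  have "polyfun_linear M X A"
    unfolding polyfun_linear_def
    by (auto simp: polyfun_space_def polyfun_add_polyfun polyfun_scale_polyfun A Tadd Tsc)
       (auto simp: A_def polyfun_space_def)
  moreover have "A (polyfun M X (f n)) = polyfun M X (g n)" if "orth_nonzero M X n" for n
  proof -
    have "T (f n) = (\<Sum>m\<le>n. if m = n then g n else 0)"
      unfolding T_def f_nth(1) using that
      by (intro sum.cong) (auto simp: c_def f_orth orth_nonzero_iff)
    then show ?thesis by (simp add: A)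
  qed
  ultimately show "\<exists>A. polyfun_linear M X A \<and>
     (\<forall>n. orth_nonzero M X n \<longrightarrow> A (polyfun M X (f n)) = polyfun M X (g n))" by blast
next
  fix A B
  assume A: "polyfun_linear M X A \<and>
     (\<forall>n. orth_nonzero M X n \<longrightarrow> A (polyfun M X (f n)) = polyfun M X (g n))"
  assume B: "polyfun_linear M X B \<and>
     (\<forall>n. orth_nonzero M X n \<longrightarrow> B (polyfun M X (f n)) = polyfun M X (g n))"
  have in_space: "polyfun M X p \<in> polyfun_space M X" for p by (simp add: polyfun_space_def)
  have lin: "L (polyfun M X (p + q)) = polyfun_add M X (L (polyfun M X p)) (L (polyfun M X q))"
     "L (polyfun M X (smult a p)) = polyfun_scale M X a (L (polyfun M X p))"
    if "polyfun_linear M X L" for L p q a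
    using that in_space unfolding polyfun_linear_def
    by (metis polyfun_add_polyfun, metis polyfun_scale_polyfun)
  have zero: "L (polyfun M X 0) = polyfun M X 0" if L: "polyfun_linear M X L" for L
  proof -
    have "L (polyfun M X 0) \<in> polyfun_space M X"
      using L in_space[of 0] unfolding polyfun_linear_def by (meson PiE_mem)
    then obtain r where r: "L (polyfun M X 0) = polyfun M X r" by (auto simp: polyfun_space_def)
    show ?thesis using lin(2)[OF L, of 0 0] by (simp add: r polyfun_scale_polyfun)
  qed
  have f_eq: "A (polyfun M X (f n)) = B (polyfun M X (f n))" for n
  proof (cases "orth_nonzero M X n")
    case False
    then have "polyfun M X (f n) = polyfun M X 0"
      by (simp add: polyfun_eq_iff orth_nonzero_def)
    then show ?thesis using zero[of A] zero[of B] A B by simp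
  qed (use A B in simp)
  have lA: "polyfun_linear M X A" and lB: "polyfun_linear M X B" using A B by auto
  note zA = zero[OF lA] and zB = zero[OF lB]
  have "A (polyfun M X (\<Sum>m<N. smult (d m) (f m))) = B (polyfun M X (\<Sum>m<N. smult (d m) (f m)))" for N d
    
    by (induction N) (simp_all add: zA zB lin(1)[OF lA] lin(1)[OF lB] lin(2)[OF lA] lin(2)[OF lB] f_eq)
  moreover have "\<exists>d N. p = (\<Sum>m<N. smult (d m) (f m))" for p
    using f_expand[of p "Suc (degree p)"] lessI by blast
  ultimately have "A (polyfun M X p) = B (polyfun M X p)" for p
    by metis
  then show "A = B"
    using lA lB unfolding polyfun_linear_def polyfun_space_def
    by (elim conjE, intro PiE_ext[of A "range (polyfun M X)" "\<lambda>_. range (polyfun M X)" B]) auto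
qed

end

end

theory Submission
  imports Defs
begin

text \<open>
  In the basis of orthogonal polynomials the three operators are shifts and a diagonal operator, and
  \<open>[a\<^sup>-, a\<^sup>+] f\<^sub>n = (\<omega>\<^sub>n\<^sub>+\<^sub>1 - \<omega>\<^sub>n) f\<^sub>n\<close>,
  \<open>[a\<^sup>0, a\<^sup>+] f\<^sub>n = (\<alpha>\<^sub>n\<^sub>+\<^sub>1 - \<alpha>\<^sub>n) f\<^sub>n\<^sub>+\<^sub>1\<close>,
  \<open>[a\<^sup>-, a\<^sup>0] f\<^sub>n = (\<alpha>\<^sub>n - \<alpha>\<^sub>n\<^sub>-\<^sub>1) \<omega>\<^sub>n f\<^sub>n\<^sub>-\<^sub>1\<close>.
  By linear independence of neighbouring \<open>f\<^sub>n\<close>, the span is closed iff \<open>\<alpha>\<^sub>n\<^sub>+\<^sub>1 - \<alpha>\<^sub>n\<close> is constant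
  and \<open>\<omega>\<^sub>n\<^sub>+\<^sub>1 - \<omega>\<^sub>n\<close> is an affine function of \<open>\<alpha>\<^sub>n\<close>; then \<open>\<omega>\<^sub>n\<close> is quadratic in \<open>n\<close>.
  For infinite support, \<open>\<omega>\<^sub>n > 0\<close> for all \<open>n\<close> forces \<open>\<beta> \<ge> 0\<close>; if \<open>X\<close> takes exactly \<open>k\<close> values,
  the commutator at \<open>f\<^sub>k\<^sub>-\<^sub>1\<close> gives the boundary condition \<open>\<omega>\<^sub>k = 0\<close>, that is \<open>t = -\<beta>(k - 1)\<close>.
\<close>

section \<open>Linear operators on polynomial functions\<close>

context
  fixes M :: "'a measure" and X :: "'a \<Rightarrow> real"
  assumes rv: "prob_space M" "X \<in> borel_measurable M" "\<And>n::nat. integrable M (\<lambda>w. X w ^ n)"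
begin

private abbreviation "P \<equiv> polyfun M X"
private abbreviation "f \<equiv> orth_poly M X"
private abbreviation "nz \<equiv> orth_nonzero M X"
private abbreviation "\<alpha> \<equiv> sj_alpha M X"

private lemmas P_eq_iff = polyfun_eq_iff[OF rv]
private lemmas P_add = polyfun_add_polyfun[OF rv]
private lemmas P_scale = polyfun_scale_polyfun[OF rv]

lemma polyfun_in_space: "P p \<in> polyfun_space M X"
  by (simp add: polyfun_space_def)

lemma polyfun_linear_ex:
  assumes "polyfun_linear M X A" shows "\<exists>q. A (P p) = P q"
  using assms polyfun_in_space[of p] unfolding polyfun_linear_def polyfun_space_def by blast

lemma polyfun_linear_simps:
  assumes "polyfun_linear M X A"
  shows "A (P (p + q)) = polyfun_add M X (A (P p)) (A (P q))"
    and "A (P (smult c p)) = polyfun_scale M X c (A (P p))"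
  using assms polyfun_in_space unfolding polyfun_linear_def
  by (metis P_add, metis P_scale)

lemma polyfun_linear_zero:
  assumes "polyfun_linear M X A" shows "A (P 0) = P 0"
  using polyfun_linear_simps(2)[OF assms, of 0 0] polyfun_linear_ex[OF assms, of 0]
  by (auto simp: P_scale)

lemma polyfun_linearI:
  assumes "A \<in> extensional (polyfun_space M X)" "\<And>p. \<exists>q. A (P p) = P q"
    "\<And>p q. A (P (p + q)) = polyfun_add M X (A (P p)) (A (P q))"
    "\<And>p c. A (P (smult c p)) = polyfun_scale M X c (A (P p))"
  shows "polyfun_linear M X A"
  using assms unfolding polyfun_linear_def
  by (auto simp: PiE_iff polyfun_space_def P_add P_scale image_iff)

section \<open>Sums, multiples, products and commutators of linear operators\<close>

lemma op_apply:
  "id_op M X (P p) = P p"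
  "op_add M X A B (P p) = polyfun_add M X (A (P p)) (B (P p))"
  "op_scale M X c A (P p) = polyfun_scale M X c (A (P p))"
  "op_comp M X A B (P p) = A (B (P p))"
  by (simp_all add: id_op_def op_add_def op_scale_def op_comp_def polyfun_in_space)

lemma op_extensional:
  "id_op M X \<in> extensional (polyfun_space M X)"
  "op_add M X A B \<in> extensional (polyfun_space M X)"
  "op_scale M X c A \<in> extensional (polyfun_space M X)"
  "op_comp M X A B \<in> extensional (polyfun_space M X)"
  by (simp_all add: id_op_def op_add_def op_scale_def op_comp_def)

lemma id_op_linear: "polyfun_linear M X (id_op M X)"
  by (rule polyfun_linearI) (auto simp: op_extensional op_apply P_add P_scale)

lemma op_scale_linear:
  assumes A: "polyfun_linear M X A" shows "polyfun_linear M X (op_scale M X c A)"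
proof (rule polyfun_linearI)
  fix p q d
  obtain p' q' where eq: "A (P p) = P p'" "A (P q) = P q'"
    using polyfun_linear_ex[OF A] by meson
  show "\<exists>r. op_scale M X c A (P p) = P r" by (auto simp: op_apply eq P_scale)
  show "op_scale M X c A (P (p + q)) =
      polyfun_add M X (op_scale M X c A (P p)) (op_scale M X c A (P q))"
    by (simp add: op_apply polyfun_linear_simps[OF A] eq P_scale P_add smult_add_right)
  show "op_scale M X c A (P (smult d p)) = polyfun_scale M X d (op_scale M X c A (P p))"
    by (simp add: op_apply polyfun_linear_simps[OF A] eq P_scale mult.commute)
qed (rule op_extensional)

lemma op_add_linear:
  assumes A: "polyfun_linear M X A" and B: "polyfun_linear M X B"
  shows "polyfun_linear M X (op_add M X A B)"
proof (rule polyfun_linearI)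
  fix p q d
  obtain p' q' p'' q'' where eq: "A (P p) = P p'" "A (P q) = P q'" "B (P p) = P p''" "B (P q) = P q''"
    using polyfun_linear_ex[OF A] polyfun_linear_ex[OF B] by meson
  show "\<exists>r. op_add M X A B (P p) = P r" by (auto simp: op_apply eq P_add)
  show "op_add M X A B (P (p + q)) =
      polyfun_add M X (op_add M X A B (P p)) (op_add M X A B (P q))"
    by (simp add: op_apply polyfun_linear_simps[OF A] polyfun_linear_simps[OF B] eq P_add add_ac)
  show "op_add M X A B (P (smult d p)) = polyfun_scale M X d (op_add M X A B (P p))"
    by (simp add: op_apply polyfun_linear_simps[OF A] polyfun_linear_simps[OF B] eq P_add P_scale
        smult_add_right)
qed (rule op_extensional)

lemma op_comp_linear:
  assumes A: "polyfun_linear M X A" and B: "polyfun_linear M X B"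
  shows "polyfun_linear M X (op_comp M X A B)"
proof (rule polyfun_linearI)
  fix p q d
  obtain p' q' where eq: "B (P p) = P p'" "B (P q) = P q'"
    using polyfun_linear_ex[OF B] by meson
  show "\<exists>r. op_comp M X A B (P p) = P r"
    using polyfun_linear_ex[OF A] by (simp add: op_apply eq)
  show "op_comp M X A B (P (p + q)) =
      polyfun_add M X (op_comp M X A B (P p)) (op_comp M X A B (P q))"
    by (simp add: op_apply polyfun_linear_simps[OF B] eq P_add polyfun_linear_simps[OF A])
  show "op_comp M X A B (P (smult d p)) = polyfun_scale M X d (op_comp M X A B (P p))"
    by (simp add: op_apply polyfun_linear_simps[OF B] eq P_scale polyfun_linear_simps[OF A])
qed (rule op_extensional)

lemma commutator_linear:
  assumes "polyfun_linear M X A" "polyfun_linear M X B"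
  shows "polyfun_linear M X (commutator M X A B)"
  unfolding commutator_def using assms by (intro op_add_linear op_scale_linear op_comp_linear)

text \<open>Uniqueness of basis operators: with \<open>g n\<close> representing the image of f_n
  under \<open>A\<close>, both operators meet the same specification. Indices with f_n(X) = 0 need
  no check.\<close>

lemma polyfun_linear_eqI:
  assumes A: "polyfun_linear M X A" and B: "polyfun_linear M X B"
    and eq: "\<And>n. nz n \<Longrightarrow> A (P (f n)) = B (P (f n))"
  shows "A = B"
proof -
  obtain g where g: "\<And>n. A (P (f n)) = P (g n)"
    using choice[of "\<lambda>n q. A (P (f n)) = P q"] polyfun_linear_ex[OF A] by blast
  show ?thesis
    using basis_operator_ex1[OF rv, of g] A B g eq by (metis (no_types, lifting))
qed

lemma basis_operator_spec:
  "polyfun_linear M X (basis_operator M X g) \<and>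
   (\<forall>n. nz n \<longrightarrow> basis_operator M X g (P (f n)) = P (g n))"
  unfolding basis_operator_def by (rule theI'[OF basis_operator_ex1[OF rv]])

section \<open>Orthogonality\<close>

text \<open>\<open>E (p * q)\<close> is the \<open>L\<^sup>2\<close> inner product, degenerate on
  polynomials when X takes finitely many values.\<close>

definition poly_mean :: "real poly \<Rightarrow> real" where
  "poly_mean p = (\<integral>w. poly p (X w) \<partial>M)"

private abbreviation "E \<equiv> poly_mean"

lemma poly_mean_simps [simp]:
  "E (p + q) = E p + E q" "E (p - q) = E p - E q" "E (smult c p) = c * E p" "E 0 = 0"
  unfolding poly_mean_def using poly_integrable[OF rv] by simp_all

lemma poly_mean_sum: "E (\<Sum>i\<in>I. g i) = (\<Sum>i\<in>I. E (g i))"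
  by (induction I rule: infinite_finite_induct) simp_all

lemma null_iff: "(AE w in M. poly p (X w) = 0) \<longleftrightarrow> E (p * p) = 0"
proof -
  have "E (p * p) = 0 \<longleftrightarrow> (AE w in M. poly (p * p) (X w) = 0)"
    unfolding poly_mean_def by (intro integral_nonneg_eq_0_iff_AE poly_integrable[OF rv]) auto
  then show ?thesis by simp
qed

lemma poly_mean_square_nonneg: "E (p * p) \<ge> 0"
  unfolding poly_mean_def by simp

lemma poly_mean_cong:
  assumes "AE w in M. poly p (X w) = poly q (X w)" shows "E (p * r) = E (q * r)"
proof -
  have [measurable]: "(\<lambda>w. poly s (X w)) \<in> borel_measurable M" for s
    using poly_integrable[OF rv] by blast
  show ?thesis
    unfolding poly_mean_def by (rule integral_cong_AE) (use assms in auto)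
qed

lemma orth_nonzero_iff: "nz n \<longleftrightarrow> E (f n * f n) \<noteq> 0"
  unfolding orth_nonzero_def null_iff ..

lemma orth_poly_null: "\<not> nz n \<Longrightarrow> P (f n) = P 0"
  by (simp add: P_eq_iff orth_nonzero_def)

lemma orth_poly_orth: "m \<noteq> n \<Longrightarrow> E (f m * f n) = 0"
  using monic_orthogonal_orth_poly[OF rv] unfolding monic_orthogonal_def
  by (simp add: poly_mean_def)

lemmas orth_poly_degree = monic_orthogonal_nth(1)[OF monic_orthogonal_orth_poly[OF rv]]
lemmas orth_poly_monic = monic_orthogonal_nth(2)[OF monic_orthogonal_orth_poly[OF rv]]

lemma orth_poly_low:
  assumes "degree p < n" shows "E (p * f n) = 0"
proof -
  obtain c where c: "p = (\<Sum>m<n. smult (c m) (f m))"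
    using monic_expansion[OF orth_poly_degree orth_poly_monic assms] by blast
  show ?thesis
    unfolding c sum_distrib_right poly_mean_sum by (intro sum.neutral) (auto simp: orth_poly_orth)
qed

text \<open>Divide f_n by \<open>q\<close>. The multiple of \<open>q\<close> is zero almost surely
  and the remainder has degree below n, so both are orthogonal to f_n, and f_n has norm 0.\<close>

lemma orth_poly_null_above:
  assumes "AE w in M. poly q (X w) = 0" "q \<noteq> 0" "degree q \<le> n"
  shows "\<not> nz n"
proof -
  have "E (q * (f n div q * f n)) = E (0 * (f n div q * f n))"
    by (rule poly_mean_cong) (use assms in simp)
  moreover have "E (f n mod q * f n) = 0"
  proof (cases "f n mod q = 0")
    case False
    then have "degree (f n mod q) < n" using degree_mod_less[OF assms(2), of "f n"] assms(3) by auto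
    then show ?thesis by (rule orth_poly_low)
  qed simp
  moreover have "f n * f n = q * (f n div q * f n) + f n mod q * f n"
    by (metis div_mult_mod_eq distrib_right mult.assoc mult.commute)
  ultimately show ?thesis by (simp add: orth_nonzero_iff)
qed

text \<open>If f_m(X) = 0, then f_m itself serves as the vanishing polynomial \<open>q\<close>. So
  the indices with f_n(X) \<noteq> 0 form an initial segment.\<close>

lemma orth_nonzero_mono:
  assumes "nz n" "m \<le> n" shows "nz m"
proof (rule ccontr)
  assume "\<not> nz m"
  moreover have "f m \<noteq> 0" using orth_poly_monic[of m] by auto
  ultimately have "\<not> nz n"
    using assms(2) by (intro orth_poly_null_above[of "f m"]) (auto simp: orth_nonzero_def orth_poly_degree)
  then show False using assms(1) by simp
qed

lemma orth_nonzero_0: "nz 0"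
proof -
  interpret prob_space M by (rule rv)
  have "f 0 = 1"
    using orth_poly_degree[of 0] orth_poly_monic[of 0]
    by (metis degree_eq_zeroE coeff_pCons_0 one_pCons)
  then show ?thesis by (simp add: orth_nonzero_def)
qed

text \<open>Compute the mean of X f_{n+1} f_n twice: the recurrence gives \<omega>_{n+1} times the
  squared norm of f_n, while moving X onto f_n gives the squared norm of f_{n+1}.\<close>

lemma sj_omega_pos:
  assumes "nz (Suc n)" shows "sj_omega M X (Suc n) > 0"
proof -
  let ?m = "Suc n"
  define r where "r = f (Suc ?m) + smult (\<alpha> ?m) (f ?m) + smult (sj_omega M X ?m) (f n)"
  have "three_term_recurrence M X (\<alpha>, sj_omega M X)"
    using three_term_recurrence_szego_jacobi[OF rv] by (simp add: sj_alpha_def sj_omega_def)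
  then have "AE w in M. X w * poly (f ?m) (X w) = poly (f (Suc ?m)) (X w) + \<alpha> ?m * poly (f ?m) (X w)
        + sj_omega M X ?m * poly (f n) (X w)"
    using assms unfolding three_term_recurrence_def prod.case by (auto dest!: spec[of _ ?m])
  then have "AE w in M. poly (pCons 0 (f ?m)) (X w) = poly r (X w)"
    by (simp add: r_def)
  then have "E (pCons 0 (f ?m) * f n) = E (r * f n)"
    by (rule poly_mean_cong)
  also have "\<dots> = sj_omega M X ?m * E (f n * f n)"
    by (simp add: r_def distrib_right orth_poly_orth)
  finally have 1: "E (pCons 0 (f ?m) * f n) = sj_omega M X ?m * E (f n * f n)" .
  \<comment> \<open>Both polynomials are monic of degree n+1, so the difference has lower degree and
    is orthogonal to f_{n+1}.\<close>
  define s where "s = pCons 0 (f n) - f ?m"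
  have "degree s \<le> ?m"
    unfolding s_def by (intro degree_diff_le) (auto simp: degree_pCons_eq_if orth_poly_degree)
  moreover have "coeff s ?m = 0" by (simp add: s_def orth_poly_monic)
  ultimately have "degree s < ?m"
    by (metis Zero_not_Suc degree_0 le_neq_implies_less leading_coeff_0_iff zero_less_Suc)
  from orth_poly_low[OF this] have "E (pCons 0 (f n) * f ?m) = E (f ?m * f ?m)"
    by (simp add: s_def left_diff_distrib)
  then have 2: "E (pCons 0 (f ?m) * f n) = E (f ?m * f ?m)" by (simp add: mult.commute)
  have "E (f ?m * f ?m) > 0" "E (f n * f n) > 0"
    using assms orth_nonzero_mono[OF assms, of n] poly_mean_square_nonneg
    by (auto simp: orth_nonzero_iff order.strict_iff_order)
  with 1 2 show ?thesis by (simp add: zero_less_mult_iff) (metis zero_less_mult_pos2)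
qed

section \<open>Commutators in the orthogonal basis\<close>

text \<open>
  If \<open>X\<close> takes exactly \<open>k\<close> values, \<open>sj_omega M X k\<close> is arbitrary; with \<open>\<omega>\<^sub>k = 0\<close> the formula for
  \<open>[a\<^sup>-, a\<^sup>+] f\<^sub>n\<close> also holds in the boundary case \<open>n = k - 1\<close>.
\<close>

definition cut_omega :: "nat \<Rightarrow> real" where
  "cut_omega n = (if n = 0 \<or> \<not> nz n then 0 else sj_omega M X n)"

private abbreviation "\<omega> \<equiv> cut_omega"

lemma cut_omega_0 [simp]: "\<omega> 0 = 0"
  by (simp add: cut_omega_def)

lemma creation_linear: "polyfun_linear M X (creation M X)"
  and preservation_linear: "polyfun_linear M X (preservation M X)"
  and annihilation_linear: "polyfun_linear M X (annihilation M X)"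
  unfolding creation_def preservation_def annihilation_def using basis_operator_spec by blast+

lemma creation_basis: "creation M X (P (f n)) = P (f (Suc n))"
proof (cases "nz n")
  case True
  then show ?thesis using basis_operator_spec[of "\<lambda>n. f (Suc n)"] unfolding creation_def by blast
next
  case False
  \<comment> \<open>Once f_n vanishes so does f_{n+1}; the formula then reads 0 = 0 and is valid for
    every n.\<close>
  moreover from this have "\<not> nz (Suc n)" using orth_nonzero_mono[of "Suc n" n] by auto
  ultimately show ?thesis by (simp add: orth_poly_null polyfun_linear_zero[OF creation_linear])
qed

lemma preservation_basis: "preservation M X (P (f n)) = P (smult (\<alpha> n) (f n))"
proof (cases "nz n")
  case True
  then show ?thesis using basis_operator_spec[of "\<lambda>n. smult (\<alpha> n) (f n)"]
    unfolding preservation_def by blast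
next
  case False
  then show ?thesis
    by (simp add: orth_poly_null polyfun_linear_zero[OF preservation_linear] P_scale[symmetric])
       (simp add: P_scale)
qed

text \<open>The zeros built into \<open>\<omega>\<close> absorb both the case n = 0, where
  \<open>n - 1\<close> is 0, and the case of vanishing f_n.\<close>

lemma annihilation_basis: "annihilation M X (P (f n)) = P (smult (\<omega> n) (f (n - 1)))"
proof (cases "nz n")
  case True
  then show ?thesis using basis_operator_spec unfolding annihilation_def
    by (auto simp: cut_omega_def)
next
  case False
  then show ?thesis
    by (simp add: orth_poly_null polyfun_linear_zero[OF annihilation_linear] cut_omega_def)
qed

section \<open>The general element of the span and its commutators\<close>

definition quantum_op :: "real \<Rightarrow> real \<Rightarrow> real \<Rightarrow> real \<Rightarrow> real poly set \<Rightarrow> real poly set" where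
  "quantum_op c0 c1 c2 c3 = op_add M X (op_scale M X c0 (id_op M X))
       (op_add M X (op_scale M X c1 (annihilation M X))
         (op_add M X (op_scale M X c2 (preservation M X))
           (op_scale M X c3 (creation M X))))"

lemma quantum_span_eq: "quantum_span M X = {quantum_op c0 c1 c2 c3 | c0 c1 c2 c3. True}"
  unfolding quantum_span_def quantum_op_def ..

lemma quantum_op_linear: "polyfun_linear M X (quantum_op c0 c1 c2 c3)"
  unfolding quantum_op_def
  by (intro op_add_linear op_scale_linear id_op_linear annihilation_linear preservation_linear
      creation_linear)

text \<open>Coefficients in the order diagonal, lower, upper. At n = 0 the lower term falls on f_0,
  so \<open>y\<close> has to be 0 there.\<close>

definition tridiag :: "nat \<Rightarrow> real \<Rightarrow> real \<Rightarrow> real \<Rightarrow> real poly" where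
  "tridiag n x y z = smult x (f n) + smult y (f (n - 1)) + smult z (f (Suc n))"

lemma quantum_op_basis:
  "quantum_op c0 c1 c2 c3 (P (f n)) = P (tridiag n (c0 + c2 * \<alpha> n) (c1 * \<omega> n) c3)"
  unfolding quantum_op_def tridiag_def
  by (simp add: op_apply creation_basis preservation_basis annihilation_basis P_scale P_add
      algebra_simps smult_add_left)

lemma linear_tridiag:
  assumes "polyfun_linear M X A" "\<And>m. A (P (f m)) = P (g m)"
  shows "A (P (tridiag n x y z)) = P (smult x (g n) + smult y (g (n - 1)) + smult z (g (Suc n)))"
  by (simp add: tridiag_def polyfun_linear_simps[OF assms(1)] assms(2) P_add P_scale)

text \<open>Terms in f_{n-2} and f_{n+2} cancel, the diagonal parts commute, and only the brackets
  of distinct operators among a-, a0, a+ survive.\<close>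

lemma commutator_basis:
  "commutator M X (quantum_op c0 c1 c2 c3) (quantum_op d0 d1 d2 d3) (P (f n)) =
   P (tridiag n ((c1 * d3 - c3 * d1) * (\<omega> (Suc n) - \<omega> n))
        ((c1 * d2 - c2 * d1) * (\<alpha> n - \<alpha> (n - 1)) * \<omega> n)
        ((c2 * d3 - c3 * d2) * (\<alpha> (Suc n) - \<alpha> n)))"
\<comment> \<open>\<open>Suc (n - 1)\<close> is n only for n > 0; at n = 0 the lower terms drop out
  by \<open>\<omega> 0 = 0\<close>. In both cases the identity already holds between
  polynomials.\<close>
proof (cases n)
  case 0
  show ?thesis
    unfolding 0
    by (simp add: commutator_def op_apply quantum_op_basis P_scale P_add
        linear_tridiag[OF quantum_op_linear quantum_op_basis],
        intro arg_cong[where f = P] poly_eqI, simp add: tridiag_def algebra_simps)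
next
  case (Suc m)
  show ?thesis
    unfolding Suc
    by (simp add: commutator_def op_apply quantum_op_basis P_scale P_add
        linear_tridiag[OF quantum_op_linear quantum_op_basis],
        intro arg_cong[where f = P] poly_eqI, simp add: tridiag_def algebra_simps)
qed

text \<open>Inner products with f_n, f_{n-1} and f_{n+1} isolate the coefficients. The first two
  have positive norm; f_{n+1} may vanish, and then \<open>z\<close> is invisible.\<close>

lemma tridiag_eq_iff:
  assumes "nz n" "n = 0 \<Longrightarrow> y = 0 \<and> y' = 0"
  shows "P (tridiag n x y z) = P (tridiag n x' y' z') \<longleftrightarrow>
    x = x' \<and> y = y' \<and> (nz (Suc n) \<longrightarrow> z = z')"
proof
  assume "P (tridiag n x y z) = P (tridiag n x' y' z')"
  then have *: "E (tridiag n x y z * f m) = E (tridiag n x' y' z' * f m)" for m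
    by (intro poly_mean_cong) (simp add: P_eq_iff)
  have "x = x'" using *[of n] assms
    by (cases "n = 0") (auto simp: tridiag_def distrib_right orth_poly_orth orth_nonzero_iff)
  moreover have "y = y'" using *[of "n - 1"] assms orth_nonzero_mono[OF assms(1), of "n - 1"]
    by (cases "n = 0") (auto simp: tridiag_def distrib_right orth_poly_orth orth_nonzero_iff)
  moreover have "z = z'" if "nz (Suc n)" using *[of "Suc n"] assms that
    by (auto simp: tridiag_def distrib_right orth_poly_orth orth_nonzero_iff)
  ultimately show "x = x' \<and> y = y' \<and> (nz (Suc n) \<longrightarrow> z = z')" by blast
next
  assume "x = x' \<and> y = y' \<and> (nz (Suc n) \<longrightarrow> z = z')"
  then show "P (tridiag n x y z) = P (tridiag n x' y' z')"
    by (cases "nz (Suc n)") (simp_all add: tridiag_def P_add[symmetric] P_scale[symmetric] orth_poly_null, simp add: P_scale)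
qed

lemma commutator_eq_iff:
  "commutator M X (quantum_op c0 c1 c2 c3) (quantum_op d0 d1 d2 d3) = quantum_op e0 e1 e2 e3 \<longleftrightarrow>
    (\<forall>n. nz n \<longrightarrow> (c1 * d3 - c3 * d1) * (\<omega> (Suc n) - \<omega> n) = e0 + e2 * \<alpha> n \<and>
      (c1 * d2 - c2 * d1) * (\<alpha> n - \<alpha> (n - 1)) * \<omega> n = e1 * \<omega> n \<and>
      (nz (Suc n) \<longrightarrow> (c2 * d3 - c3 * d2) * (\<alpha> (Suc n) - \<alpha> n) = e3))"
  (is "?C = ?Q \<longleftrightarrow> ?R")
proof -
  have "?C = ?Q \<longleftrightarrow> (\<forall>n. nz n \<longrightarrow> ?C (P (f n)) = ?Q (P (f n)))"
    using polyfun_linear_eqI[OF commutator_linear[OF quantum_op_linear quantum_op_linear] quantum_op_linear]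
    by metis
  also have "\<dots> \<longleftrightarrow> ?R"
    unfolding commutator_basis quantum_op_basis
    by (intro iff_allI imp_cong refl tridiag_eq_iff) auto
  finally show ?thesis .
qed

text \<open>The brackets [a0, a+] and [a-, a+] yield the two conditions; the one from [a-, a0] then
  follows.\<close>

lemma commutator_closed_iff:
  "commutator_closed M X (quantum_span M X) \<longleftrightarrow>
    (\<exists>a r s. (\<forall>n. nz (Suc n) \<longrightarrow> \<alpha> (Suc n) - \<alpha> n = a) \<and>
       (\<forall>n. nz n \<longrightarrow> \<omega> (Suc n) - \<omega> n = s + r * \<alpha> n))"
proof
  assume "commutator_closed M X (quantum_span M X)"
  then have *: "\<exists>e0 e1 e2 e3. commutator M X (quantum_op c0 c1 c2 c3) (quantum_op d0 d1 d2 d3)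
      = quantum_op e0 e1 e2 e3" for c0 c1 c2 c3 d0 d1 d2 d3
    unfolding commutator_closed_def quantum_span_eq by blast
  obtain a where "\<And>n. nz n \<Longrightarrow> nz (Suc n) \<Longrightarrow> \<alpha> (Suc n) - \<alpha> n = a"
    \<comment> \<open>The bracket [a0, a+]; \<open>a\<close> is its coefficient of a+.\<close>
    using *[of 0 0 1 0 0 0 0 1] unfolding commutator_eq_iff by auto
  then have 1: "\<forall>n. nz (Suc n) \<longrightarrow> \<alpha> (Suc n) - \<alpha> n = a"
    using orth_nonzero_mono le_SucI by blast
  obtain s r where "\<forall>n. nz n \<longrightarrow> \<omega> (Suc n) - \<omega> n = s + r * \<alpha> n"
    \<comment> \<open>The bracket [a-, a+]; \<open>s\<close> and \<open>r\<close> are its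
      coefficients of the identity and of a0.\<close>
    using *[of 0 1 0 0 0 0 0 1] unfolding commutator_eq_iff by auto
  with 1 show "\<exists>a r s. (\<forall>n. nz (Suc n) \<longrightarrow> \<alpha> (Suc n) - \<alpha> n = a) \<and>
       (\<forall>n. nz n \<longrightarrow> \<omega> (Suc n) - \<omega> n = s + r * \<alpha> n)" by blast
next
  assume "\<exists>a r s. (\<forall>n. nz (Suc n) \<longrightarrow> \<alpha> (Suc n) - \<alpha> n = a) \<and>
       (\<forall>n. nz n \<longrightarrow> \<omega> (Suc n) - \<omega> n = s + r * \<alpha> n)"
  then obtain a r s where a: "\<And>n. nz (Suc n) \<Longrightarrow> \<alpha> (Suc n) - \<alpha> n = a"
    and w: "\<And>n. nz n \<Longrightarrow> \<omega> (Suc n) - \<omega> n = s + r * \<alpha> n" by blast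
  have a': "(\<alpha> n - \<alpha> (n - 1)) * \<omega> n = a * \<omega> n" if "nz n" for n
    using a[of "n - 1"] that by (cases n) auto
  \<comment> \<open>Structure constants: [a-, a+] = s + r a0, [a-, a0] = a a-, [a0, a+] = a
    a+.\<close>
  have "commutator M X (quantum_op c0 c1 c2 c3) (quantum_op d0 d1 d2 d3) =
    quantum_op ((c1 * d3 - c3 * d1) * s) ((c1 * d2 - c2 * d1) * a) ((c1 * d3 - c3 * d1) * r)
      ((c2 * d3 - c3 * d2) * a)" for c0 c1 c2 c3 d0 d1 d2 d3
    unfolding commutator_eq_iff using a a' w
    by (auto simp: mult.assoc distrib_left)
  then show "commutator_closed M X (quantum_span M X)"
    unfolding commutator_closed_def quantum_span_eq by blast
qed

section \<open>The support\<close>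

text \<open>Every point outside the support lies in an interval with rational endpoints that X hits
  with probability 0, and there are only countably many of these.\<close>

lemma AE_in_rv_support: "AE w in M. X w \<in> rv_support M X"
proof -
  interpret prob_space M by (rule rv)
  note [measurable] = rv(2)
  define I where "I = {(a::rat, b::rat). prob {w \<in> space M. X w \<in> {of_rat a<..<of_rat b}} = 0}"
  have "AE w in M. \<forall>(a, b)\<in>I. X w \<notin> {of_rat a<..<of_rat b}"
  proof (subst AE_ball_countable)
    show "countable I" by simp
    show "\<forall>i\<in>I. AE w in M. case i of (a, b) \<Rightarrow> X w \<notin> {of_rat a<..<of_rat b}"
    proof safe
      fix a b assume "(a, b) \<in> I"
      then have "prob {w \<in> space M. X w \<in> {of_rat a<..<of_rat b}} = 0" by (simp add: I_def)
      then show "AE w in M. X w \<notin> {of_rat a<..<of_rat b}"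
        by (subst (asm) prob_eq_0) auto
    qed
  qed
  then show ?thesis
  proof eventually_elim
    case (elim w)
    show ?case
    proof (rule ccontr)
      assume "X w \<notin> rv_support M X"
      then obtain e where e: "e > 0" "\<not> prob {v \<in> space M. X v \<in> ball (X w) e} > 0"
        by (auto simp: rv_support_def)
      then have e0: "prob {v \<in> space M. X v \<in> ball (X w) e} = 0"
        by (simp add: measure_nonneg order.strict_iff_order)
      obtain a b where ab: "X w - e < of_rat a" "of_rat a < X w" "X w < of_rat b" "of_rat b < X w + e"
        using of_rat_dense[of "X w - e" "X w"] of_rat_dense[of "X w" "X w + e"] e by auto
      have "prob {v \<in> space M. X v \<in> {of_rat a<..<of_rat b}} \<le> prob {v \<in> space M. X v \<in> ball (X w) e}"
        using ab by (intro finite_measure_mono) (auto simp: dist_real_def)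
      then have "prob {v \<in> space M. X v \<in> {of_rat a<..<of_rat b}} = 0"
        unfolding e0 measure_le_0_iff .
      then have "(a, b) \<in> I" by (simp add: I_def)
      then show False using elim ab by auto
    qed
  qed
qed

section \<open>Number of values versus number of nonvanishing polynomials\<close>

lemma orth_nonzero_finite_range:
  assumes "finite S" "AE w in M. X w \<in> S" "nz n" shows "n < card S"
proof (rule ccontr)
  assume "\<not> n < card S"
  \<comment> \<open>The nodal polynomial of \<open>S\<close> vanishes on X almost surely, so f_n
    does too from its degree on.\<close>
  define q where "q = (\<Prod>x\<in>S. [:- x, 1:])"
  have "poly q x = 0" if "x \<in> S" for x using that assms(1) by (auto simp: q_def poly_prod)
  then have "AE w in M. poly q (X w) = 0" using assms(2) by auto
  moreover have "degree q = card S" unfolding q_def by (subst degree_prod_eq_sum_degree) auto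
  moreover have "q \<noteq> 0" using assms(1) by (auto simp: q_def)
  ultimately have "\<not> nz n" using \<open>\<not> n < card S\<close> by (intro orth_poly_null_above) auto
  then show False using assms(3) by simp
qed

lemma infinite_rv_support:
  assumes "\<And>n. nz n" shows "infinite (rv_support M X)"
  using orth_nonzero_finite_range[OF _ AE_in_rv_support assms] by blast

text \<open>For n < k, f_n has at most n roots, so it is nonzero at some atom of X.\<close>

lemma takes_exactly_orth_nonzero:
  assumes "takes_exactly M X k" shows "nz n \<longleftrightarrow> n < k"
proof
  interpret prob_space M by (rule rv)
  note [measurable] = rv(2)
  obtain S where S: "finite S" "card S = k" "AE w in M. X w \<in> S"
    "\<And>x. x \<in> S \<Longrightarrow> measure M {w \<in> space M. X w = x} > 0"
    using assms unfolding takes_exactly_def by blast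
  show "nz n \<Longrightarrow> n < k" using orth_nonzero_finite_range[OF S(1,3)] S(2) by blast
  assume "n < k"
  have "f n \<noteq> 0" using orth_poly_monic[of n] by auto
  then have "card {x. poly (f n) x = 0} \<le> n" "finite {x. poly (f n) x = 0}"
    using card_poly_roots_bound[of "f n"] poly_roots_finite[of "f n"] orth_poly_degree[of n] by auto
  then have "\<not> S \<subseteq> {x. poly (f n) x = 0}"
    using \<open>n < k\<close> S(2) card_mono[of "{x. poly (f n) x = 0}" S] by auto
  then obtain x where x: "x \<in> S" "poly (f n) x \<noteq> 0" by blast
  show "nz n"
    unfolding orth_nonzero_def
  proof
    assume "AE w in M. poly (f n) (X w) = 0"
    then have "AE w in M. X w \<noteq> x" by eventually_elim (use x in auto)
    then have "measure M {w \<in> space M. X w = x} = 0"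
      by (subst prob_eq_0) auto
    then show False using S(4)[OF x(1)] by simp
  qed
qed

lemma takes_exactly_rv_support:
  assumes "takes_exactly M X k" shows "finite (rv_support M X)"
proof -
  interpret prob_space M by (rule rv)
  note [measurable] = rv(2)
  obtain S where S: "finite S" "AE w in M. X w \<in> S"
    using assms unfolding takes_exactly_def by blast
  have "rv_support M X \<subseteq> S"
  proof
    fix x assume x: "x \<in> rv_support M X"
    show "x \<in> S"
    proof (rule ccontr)
      assume "x \<notin> S"
      then obtain e where e: "e > 0" "ball x e \<inter> S = {}"
        using open_contains_ball[of "- S"] finite_imp_closed[OF S(1)] by (force simp: open_Compl)
      have "AE w in M. X w \<notin> ball x e" using S(2) by eventually_elim (use e in auto)
      then have "prob {w \<in> space M. X w \<in> ball x e} = 0"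
        by (subst prob_eq_0) auto
      then show False using x e(1) by (force simp: rv_support_def)
    qed
  qed
  then show ?thesis using S(1) finite_subset by blast
qed

text \<open>X lies among the finitely many roots of f_n; discarding roots of probability 0 leaves
  exactly the atoms.\<close>

lemma takes_exactly_ex:
  assumes "\<not> nz n" shows "\<exists>k\<ge>1. takes_exactly M X k"
proof -
  interpret prob_space M by (rule rv)
  note [measurable] = rv(2)
  define R where "R = {x. poly (f n) x = 0}"
  define S where "S = {x\<in>R. prob {w \<in> space M. X w = x} > 0}"
  have "f n \<noteq> 0" using orth_poly_monic[of n] by auto
  then have fin: "finite R" unfolding R_def by (rule poly_roots_finite)
  have "AE w in M. X w \<in> R" using assms by (simp add: orth_nonzero_def R_def)
  moreover have "AE w in M. \<forall>x\<in>R - S. X w \<noteq> x"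
  proof (subst AE_ball_countable)
    show "countable (R - S)" using fin by (intro countable_finite) auto
    show "\<forall>x\<in>R - S. AE w in M. X w \<noteq> x"
    proof
      fix x assume "x \<in> R - S"
      then have "prob {w \<in> space M. X w = x} = 0"
        by (simp add: S_def measure_nonneg order.strict_iff_order)
      then show "AE w in M. X w \<noteq> x" by (subst (asm) prob_eq_0) auto
    qed
  qed
  ultimately have AE: "AE w in M. X w \<in> S" by eventually_elim auto
  have "finite S" using fin by (simp add: S_def)
  with AE have te: "takes_exactly M X (card S)"
    unfolding takes_exactly_def by (intro exI[of _ S]) (auto simp: S_def)
  with orth_nonzero_0 have "card S \<ge> 1" by (simp add: takes_exactly_orth_nonzero)
  with te show ?thesis by blast
qed

section \<open>The Meixner--Lie class\<close>

text \<open>The affine recursion for \<open>\<omega>\<close> integrates to the quadratic form with \<open>\<beta> = r a / 2\<close>, \<open>t = \<omega>\<^sub>1\<close>.\<close>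

lemma meixner_parameters:
  assumes a: "\<forall>n. nz (Suc n) \<longrightarrow> \<alpha> (Suc n) - \<alpha> n = a"
    and w: "\<forall>n. nz n \<longrightarrow> \<omega> (Suc n) - \<omega> n = s + r * \<alpha> n"
  shows "nz n \<Longrightarrow> \<alpha> n = a * real n + \<alpha> 0"
    and "nz n \<Longrightarrow> \<omega> (Suc n) = r * a / 2 * real (Suc n) ^ 2 + (s + r * \<alpha> 0 - r * a / 2) * real (Suc n)"
proof -
  show 1: "\<alpha> n = a * real n + \<alpha> 0" if "nz n" for n
    using that
  proof (induction n)
    case (Suc n)
    then show ?case using a[rule_format, of n] orth_nonzero_mono[of "Suc n" n] by (simp add: algebra_simps)
  qed simp
  \<comment> \<open>Requiring only \<open>nz n\<close> extends the formula one index past the last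
    nonvanishing polynomial, as the boundary condition demands.\<close>
  show "\<omega> (Suc n) = r * a / 2 * real (Suc n) ^ 2 + (s + r * \<alpha> 0 - r * a / 2) * real (Suc n)"
    if "nz n" for n
    using that
  proof (induction n)
    case 0
    then show ?case using w[rule_format, OF 0] by simp
  next
    case (Suc n)
    then have "nz n" using orth_nonzero_mono[of "Suc n" n] by simp
    with Suc.IH w[rule_format, OF Suc.prems] 1[OF Suc.prems] show ?case
      by (simp add: power2_eq_square field_simps)
  qed
qed

section \<open>The cases of infinite support and of finitely many values\<close>

lemma cut_omega_Suc:
  "nz (Suc n) \<Longrightarrow> \<omega> (Suc n) = sj_omega M X (Suc n)" "\<not> nz (Suc n) \<Longrightarrow> \<omega> (Suc n) = 0"
  by (simp_all add: cut_omega_def)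

lemma commutator_closed_iff_infinite:
  assumes nz: "\<And>n. nz n"
  shows "commutator_closed M X (quantum_span M X) \<longleftrightarrow> meixner_u_f M X"
proof
  assume "commutator_closed M X (quantum_span M X)"
  then obtain a r s where a: "\<forall>n. nz (Suc n) \<longrightarrow> \<alpha> (Suc n) - \<alpha> n = a"
    and w: "\<forall>n. nz n \<longrightarrow> \<omega> (Suc n) - \<omega> n = s + r * \<alpha> n"
    unfolding commutator_closed_iff by blast
  define b t where "b = r * a / 2" and "t = s + r * \<alpha> 0"
  have omega: "sj_omega M X (Suc n) = b * real (Suc n) ^ 2 + (t - b) * real (Suc n)" for n
    using meixner_parameters(2)[OF a w nz, of n] nz by (simp add: cut_omega_Suc b_def t_def)
  \<comment> \<open>\<omega>_{n+1} factors as (n+1)(bn + t). Positivity for large n gives b \<ge> 0,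
    and n = 0 gives t > 0.\<close>
  have pos: "b * real n + t > 0" for n
  proof -
    have "sj_omega M X (Suc n) = (b * real n + t) * real (Suc n)"
      unfolding omega by (simp add: power2_eq_square algebra_simps)
    then show ?thesis using sj_omega_pos[OF nz, of n] by (simp add: zero_less_mult_iff)
  qed
  have "b \<ge> 0"
  proof (rule ccontr)
    assume "\<not> b \<ge> 0"
    then obtain n where "t < real n * (- b)" using reals_Archimedean3[of "- b"] by auto
    then show False using pos[of n] by (simp add: algebra_simps)
  qed
  moreover have "t > 0" using pos[of 0] by simp
  moreover have "a \<noteq> 0 \<or> a = 0 \<and> b = 0" by (simp add: b_def)
  moreover have "\<forall>n. \<alpha> n = a * real n + \<alpha> 0" using meixner_parameters(1)[OF a w nz] by blast
  moreover have "\<forall>n\<ge>1. sj_omega M X n = b * real n ^ 2 + (t - b) * real n"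
  proof (intro allI impI)
    fix n :: nat assume "n \<ge> 1"
    then show "sj_omega M X n = b * real n ^ 2 + (t - b) * real n" using omega[of "n - 1"] by simp
  qed
  ultimately show "meixner_u_f M X"
    unfolding meixner_u_f_def using infinite_rv_support[OF nz] by blast
next
  assume "meixner_u_f M X"
  then obtain a b t where ab: "a \<noteq> 0 \<or> a = 0 \<and> b = 0"
    and \<alpha>: "\<And>n. \<alpha> n = a * real n + \<alpha> 0"
    and omega: "\<And>n. n \<ge> 1 \<Longrightarrow> sj_omega M X n = b * real n ^ 2 + (t - b) * real n"
    unfolding meixner_u_f_def by blast
  have w: "\<omega> n = b * real n ^ 2 + (t - b) * real n" for n
    using omega[of n] nz by (cases "n = 0") (auto simp: cut_omega_def)
  have "\<alpha> (Suc n) - \<alpha> n = a" for n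
    using \<alpha>[of n] \<alpha>[of "Suc n"] by (simp add: algebra_simps)
  \<comment> \<open>The increment is 2bn + t, so the slope r must satisfy r a = 2b. If a = 0 then b
    = 0, and \<open>2 * b / a\<close> is 0 as wanted.\<close>
  moreover have "\<omega> (Suc n) - \<omega> n = (t - 2 * b / a * \<alpha> 0) + 2 * b / a * \<alpha> n" for n
  proof -
    have "\<omega> (Suc n) - \<omega> n = 2 * b * real n + t"
      unfolding w by (simp add: power2_eq_square algebra_simps)
    also have "2 * b = 2 * b / a * a" using ab by auto
    finally show ?thesis using \<alpha>[of n] by (simp add: algebra_simps)
  qed
  ultimately show "commutator_closed M X (quantum_span M X)"
    unfolding commutator_closed_iff by blast
qed

lemma commutator_closed_iff_finite:
  assumes k: "takes_exactly M X k" "k \<ge> 1"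
  shows "commutator_closed M X (quantum_span M X) \<longleftrightarrow> meixner_b_f M X"
proof
  note nz = takes_exactly_orth_nonzero[OF k(1)]
  assume "commutator_closed M X (quantum_span M X)"
  then obtain a r s where a: "\<forall>n. nz (Suc n) \<longrightarrow> \<alpha> (Suc n) - \<alpha> n = a"
    and w: "\<forall>n. nz n \<longrightarrow> \<omega> (Suc n) - \<omega> n = s + r * \<alpha> n"
    unfolding commutator_closed_iff by blast
  show "meixner_b_f M X"
  proof (cases "k = 1")
    case True
    \<comment> \<open>For k = 1 only t = 0 and a nonzero slope are required; the conditions on
      \<omega> are vacuous.\<close>
    then show ?thesis unfolding meixner_b_f_def using k
      by (intro exI[of _ k] conjI exI[of _ "1::real"] exI[of _ "0::real"]) auto
  next
    case False
    with k(2) have k2: "k \<ge> 2" by simp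
    define b t where "b = r * a / 2" and "t = s + r * \<alpha> 0"
    have w': "\<omega> (Suc n) = b * real (Suc n) ^ 2 + (t - b) * real (Suc n)" if "n < k" for n
      using meixner_parameters(2)[OF a w] that nz by (simp add: b_def t_def)
    have omega: "\<forall>n\<in>{1..k - 1}. sj_omega M X n = b * real n ^ 2 + (t - b) * real n"
    proof
      fix n assume "n \<in> {1..k - 1}"
      then obtain m where "n = Suc m" "Suc m < k" by (cases n) auto
      then show "sj_omega M X n = b * real n ^ 2 + (t - b) * real n"
        using w'[of m] cut_omega_Suc(1)[of m] nz[of "Suc m"] by (metis Suc_lessD)
    qed
    have "sj_omega M X 1 > 0" using sj_omega_pos[of 0] nz k2 by simp
    moreover have "sj_omega M X 1 = t" using omega k2 by simp
    ultimately have "t > 0" by simp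
    \<comment> \<open>The quadratic formula also holds at k, where the cut value is 0; dividing by k
      gives t.\<close>
    have "\<omega> k = 0" using nz by (simp add: cut_omega_def)
    then have "b * real k ^ 2 + (t - b) * real k = 0"
      using w'[of "k - 1"] k(2) by simp
    then have "(b * (real k - 1) + t) * real k = 0"
      by (simp add: power2_eq_square algebra_simps)
    then have t: "t = - b * (real k - 1)" using k(2) by simp
    \<comment> \<open>a = 0 would force b = 0 and hence t = 0.\<close>
    with \<open>t > 0\<close> have "a \<noteq> 0" by (auto simp: b_def)
    moreover have "\<forall>n\<le>k - 1. \<alpha> n = a * real n + \<alpha> 0"
    proof (intro allI impI)
      fix n assume "n \<le> k - 1"
      then have "nz n" using nz k2 by simp
      then show "\<alpha> n = a * real n + \<alpha> 0" by (rule meixner_parameters(1)[OF a w])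
    qed
    ultimately show ?thesis
      unfolding meixner_b_f_def using k omega t \<open>t > 0\<close> by blast
  qed
next
  note nz = takes_exactly_orth_nonzero[OF k(1)]
  assume "meixner_b_f M X"
  then obtain l a b t where l: "l \<ge> 1" "takes_exactly M X l"
    and \<alpha>': "\<And>n. n \<le> l - 1 \<Longrightarrow> \<alpha> n = a * real n + \<alpha> 0"
    and omega': "\<And>n. n \<in> {1..l - 1} \<Longrightarrow> sj_omega M X n = b * real n ^ 2 + (t - b) * real n"
    and t': "t = - b * (real l - 1)" and "a \<noteq> 0"
    unfolding meixner_b_f_def by blast
  have "l = k" using nz takes_exactly_orth_nonzero[OF l(2)] by (metis linorder_neq_iff)
  note \<alpha> = \<alpha>'[unfolded \<open>l = k\<close>] and omega = omega'[unfolded \<open>l = k\<close>] and t = t'[unfolded \<open>l = k\<close>]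
  \<comment> \<open>Including n = k is what uses t = -b(k - 1): the quadratic then vanishes at k, as
    does \<open>\<omega> k\<close>.\<close>
  have w: "\<omega> n = b * real n ^ 2 + (t - b) * real n" if "n \<le> k" for n
  proof -
    have "n = 0 \<or> n \<in> {1..k - 1} \<or> n = k" using that by auto
    then consider "n = 0" | "n \<in> {1..k - 1}" | "n = k" by blast
    then show ?thesis
    proof cases
      case 3
      then have "\<omega> n = 0" using nz by (simp add: cut_omega_def)
      moreover have "b * real k ^ 2 + (- b * (real k - 1) - b) * real k = 0"
        by (simp add: power2_eq_square algebra_simps)
      ultimately show ?thesis using 3 t by simp
    next
      case 2
      then have "nz n" using k(2) unfolding nz by auto
      then show ?thesis using 2 omega[of n] by (simp add: cut_omega_def)
    qed simp
  qed
  have "\<alpha> (Suc n) - \<alpha> n = a" if "nz (Suc n)" for n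
    using that nz \<alpha>[of n] \<alpha>[of "Suc n"] by (simp add: algebra_simps)
  moreover have "\<omega> (Suc n) - \<omega> n = (t - 2 * b / a * \<alpha> 0) + 2 * b / a * \<alpha> n" if "nz n" for n
  proof -
    have "n < k" using that nz by simp
    then have "\<omega> (Suc n) - \<omega> n = 2 * b * real n + t"
      by (simp add: w power2_eq_square algebra_simps)
    also have "2 * b = 2 * b / a * a" using \<open>a \<noteq> 0\<close> by auto
    finally show ?thesis using \<alpha>[of n] \<open>n < k\<close> by (simp add: algebra_simps)
  qed
  ultimately show "commutator_closed M X (quantum_span M X)"
    unfolding commutator_closed_iff by blast
qed

text \<open>Either no f_n vanishes or X takes finitely many values; each case excludes one of the
  two subclasses.\<close>

lemma commutator_closed_iff_meixner_lie:
  "commutator_closed M X (quantum_span M X) \<longleftrightarrow> meixner_lie M X"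
proof (cases "\<forall>n. nz n")
  case True
  then have "\<not> takes_exactly M X k" for k using takes_exactly_orth_nonzero by blast
  then have "\<not> meixner_b_f M X" by (simp add: meixner_b_f_def)
  then show ?thesis using commutator_closed_iff_infinite True by (simp add: meixner_lie_def)
next
  case False
  then obtain k where k: "takes_exactly M X k" "k \<ge> 1" using takes_exactly_ex by blast
  then have "\<not> meixner_u_f M X" using takes_exactly_rv_support by (auto simp: meixner_u_f_def)
  then show ?thesis using commutator_closed_iff_finite[OF k] by (simp add: meixner_lie_def)
qed

end

theorem lemma3p3:
  fixes M :: "'a measure" and X :: "'a \<Rightarrow> real"
  assumes "prob_space M"
    and "X \<in> borel_measurable M"
    and "\<And>n::nat. integrable M (\<lambda>w. X w ^ n)"
  shows "commutator_closed M X (quantum_span M X) \<longleftrightarrow> meixner_lie M X"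
  by (rule commutator_closed_iff_meixner_lie[OF assms])

end
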